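(* Let $D$ be a normed division ring and $R\subseteq D\setminus\{0\}$ a norm-finite subset. Then for each $n\in\mathbb{N}$ there are only finitely many non-commutative friezes over $R$ of height $n$ with all boundary entries equal to $1$.
   Context: A normed division ring is an associative ring $D$ with unity in which every non-zero element is invertible, together with a function $\lVert\cdot\rVert:D\to\mathbb{R}_{\ge0}$ such that $\lVert a\rVert=0\Leftrightarrow a=0$, $\lVert ab\rVert=\lVert a\rVert\lVert b\rVert$ and $\lVert a+b\rVert\le\lVert a\rVert+\lVert b\rVert$ for all $a,b\in D$. A subset $R\subseteq D\setminus\{0\}$ is norm-finite if for every real number $N$ the set $\{a\in R : \lVert a\rVert\le N\}$ is finite. Non-commutative friezes. Let $D$ be a ring with unit group $D^{*}$ and let $\mathcal{P}$ be an $m$-gon ($m\ge3$) with vertices $0,1,\dots,m-1$ in cyclic order (indices modulo $m$). Let $\mathrm{diag}(\mathcal{P})$ be the set of ordered pairs of distinct vertices (edges included, both orientations). A non-commutative frieze over $D$ on $\mathcal{P}$ is a map $c:\mathrm{diag}(\mathcal{P})\to D^{*}$, $(r,s)\mapsto c_{r,s}$, satisfying: (a) for all $r$: $c_{r+1,r+2}c_{r,r+2}^{-1}c_{r,r+1}=c_{r+1,r}c_{r+2,r}^{-1}c_{r+2,r+1}$; (b) for all $r,s$ with $r,r+1,s,s+1$ pairwise distinct: $c_{s,r}=c_{s,s+1}c_{r+1,s+1}^{-1}c_{r+1,r}+c_{s,r+1}c_{s+1,r+1}^{-1}c_{s+1,r}$, $c_{r,s}=c_{r,r+1}c_{s+1,r+1}^{-1}c_{s+1,s}+c_{r,s+1}c_{r+1,s+1}^{-1}c_{r+1,s}$,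 $c_{r+1,s+1}=c_{r+1,r}c_{s,r}^{-1}c_{s,s+1}+c_{r+1,s}c_{r,s}^{-1}c_{r,s+1}$, $c_{s+1,r+1}=c_{s+1,s}c_{r,s}^{-1}c_{r,r+1}+c_{s+1,r}c_{s,r}^{-1}c_{s,r+1}$. The boundary entries are the $c_{r,r+1}$ and $c_{r+1,r}$. The frieze has height $n$ if $m=n+3$. For a subset $R\subseteq D\setminus\{0\}$ of a division ring $D$, a non-commutative frieze over $R$ is a non-commutative frieze over $D$ all of whose entries $c_{r,s}$ ($r\ne s$) lie in $R$ (inverses are taken in $D$). *)

theory Defs
  imports Complex_Main "HOL-Library.FuncSet"
begin

definition division_ring_norm :: "('a::division_ring \<Rightarrow> real) \<Rightarrow> bool" where
  "division_ring_norm nrm \<longleftrightarrow>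
     (\<forall>a. 0 \<le> nrm a) \<and>
     (\<forall>a. nrm a = 0 \<longleftrightarrow> a = 0) \<and>
     (\<forall>a b. nrm (a * b) = nrm a * nrm b) \<and>
     (\<forall>a b. nrm (a + b) \<le> nrm a + nrm b)"

definition norm_finite :: "('a::division_ring \<Rightarrow> real) \<Rightarrow> 'a set \<Rightarrow> bool" where
  "norm_finite nrm R \<longleftrightarrow> R \<subseteq> - {0} \<and> (\<forall>N::real. finite {a \<in> R. nrm a \<le> N})"

text \<open>The vertices of an m-gon are \<open>0, \<dots>, m - 1\<close>; indices are taken modulo \<open>m\<close>.\<close>

definition diag :: "nat \<Rightarrow> (nat \<times> nat) set" where
  "diag m = {(r, s). r < m \<and> s < m \<and> r \<noteq> s}"

definition nxt :: "nat \<Rightarrow> nat \<Rightarrow> nat" where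
  "nxt m r = (r + 1) mod m"

text \<open>
  A map on \<open>diag m\<close> is represented by a function that is \<open>undefined\<close> outside \<open>diag m\<close>
  (extensional function space), so distinct functions are distinct friezes and counting
  them is meaningful. In a division ring the units are the nonzero elements.
\<close>

definition nc_frieze :: "nat \<Rightarrow> (nat \<times> nat \<Rightarrow> 'a::division_ring) \<Rightarrow> bool" where
  "nc_frieze m c \<longleftrightarrow>
     3 \<le> m \<and> c \<in> diag m \<rightarrow>\<^sub>E - {0} \<and>
     (\<forall>r<m. let r1 = nxt m r; r2 = nxt m r1 in
        c (r1, r2) * inverse (c (r, r2)) * c (r, r1)
        = c (r1, r) * inverse (c (r2, r)) * c (r2, r1)) \<and>
     (\<forall>r<m. \<forall>s<m. let r1 = nxt m r; s1 = nxt m s in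
        distinct [r, r1, s, s1] \<longrightarrow>
          c (s, r) = c (s, s1) * inverse (c (r1, s1)) * c (r1, r)
                   + c (s, r1) * inverse (c (s1, r1)) * c (s1, r) \<and>
          c (r, s) = c (r, r1) * inverse (c (s1, r1)) * c (s1, s)
                   + c (r, s1) * inverse (c (r1, s1)) * c (r1, s) \<and>
          c (r1, s1) = c (r1, r) * inverse (c (s, r)) * c (s, s1)
                     + c (r1, s) * inverse (c (r, s)) * c (r, s1) \<and>
          c (s1, r1) = c (s1, s) * inverse (c (r, s)) * c (r, r1)
                     + c (s1, r) * inverse (c (s, r)) * c (s, r1))"

definition nc_frieze_over :: "'a::division_ring set \<Rightarrow> nat \<Rightarrow> (nat \<times> nat \<Rightarrow> 'a) \<Rightarrow> bool" where
  "nc_frieze_over R m c \<longleftrightarrow> nc_frieze m c \<and> (\<forall>p \<in> diag m. c p \<in> R)"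

definition unit_boundary :: "nat \<Rightarrow> (nat \<times> nat \<Rightarrow> 'a::division_ring) \<Rightarrow> bool" where
  "unit_boundary m c \<longleftrightarrow> (\<forall>r<m. c (r, nxt m r) = 1 \<and> c (nxt m r, r) = 1)"

text \<open>Here \<open>n\<close> is the height: a frieze of height \<open>n\<close> lives on an \<open>(n + 3)\<close>-gon.\<close>

definition unit_boundary_friezes ::
  "'a::division_ring set \<Rightarrow> nat \<Rightarrow> (nat \<times> nat \<Rightarrow> 'a) set" where
  "unit_boundary_friezes R n = {c. nc_frieze_over R (n + 3) c \<and> unit_boundary (n + 3) c}"

end

theory Submission
  imports Defs
begin

text \<open>
  The reason for finiteness is that all entries of such a frieze obey a bound which depends only
  on the number \<open>m\<close> of vertices and on a lower bound \<open>\<epsilon>\<close> for the norms of elements of \<open>R\<close>; norm-finiteness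
  provides \<open>\<epsilon> > 0\<close> and leaves finitely many candidates for each entry.

  To find the bound, fix a vertex \<open>r\<close> and compare the rows \<open>r\<close> and \<open>r + 1\<close>. When the boundary
  entries are \<open>1\<close>, the exchange relation expressing \<open>c\<^bsub>r+1,s+1\<^esub>\<close>, multiplied by
  the inverse of \<open>c\<^bsub>r,s+1\<^esub>\<close> on the right, says that the ratio of the two rows grows by a
  controlled amount:
  \<open>c\<^bsub>r+1,s+1\<^esub> c\<^bsub>r,s+1\<^esub>\<^sup>-\<^sup>1 = c\<^bsub>r+1,s\<^esub> c\<^bsub>r,s\<^esub>\<^sup>-\<^sup>1 + c\<^bsub>s,r\<^esub>\<^sup>-\<^sup>1 c\<^bsub>r,s+1\<^esub>\<^sup>-\<^sup>1\<close>.
  The last summand has norm at most \<open>1/\<epsilon>\<^sup>2\<close>, and the ratio starts at \<open>c\<^bsub>r,r+2\<^esub>\<^sup>-\<^sup>1\<close> for \<open>s = r + 2\<close>.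
  Telescoping bounds every ratio by \<open>K = m/\<epsilon>\<^sup>2\<close> (lemma \<open>row_ratio_bound\<close>). In the column of
  a vertex \<open>s\<close>, passing from \<open>c\<^bsub>r,s\<^esub>\<close> to \<open>c\<^bsub>r+1,s\<^esub>\<close> thus multiplies the norm by at most \<open>K\<close>;
  walking around the polygon from the boundary entry \<open>c\<^bsub>s+1,s\<^esub> = 1\<close> gives the bound \<open>K\<^sup>m\<close> for
  all entries (lemma \<open>entry_bound\<close>).
\<close>

lemma division_ring_norm_one:
  assumes "division_ring_norm nrm"
  shows "nrm 1 = 1"
proof -
  have "nrm 1 * nrm 1 = nrm 1" "nrm 1 \<noteq> 0"
    using assms unfolding division_ring_norm_def by (metis mult_1, simp)
  then show ?thesis by simp
qed

lemma division_ring_norm_inverse: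
  assumes "division_ring_norm nrm" "a \<noteq> 0"
  shows "nrm (inverse a) = 1 / nrm a"
proof -
  have "nrm a * nrm (inverse a) = 1" "nrm a \<noteq> 0"
    using assms division_ring_norm_one[OF assms(1)]
    unfolding division_ring_norm_def by (metis right_inverse, simp)
  then show ?thesis by (simp add: field_simps)
qed

lemma norm_finite_bounded_below:
  assumes "division_ring_norm nrm" "norm_finite nrm R"
  obtains \<epsilon> where "0 < \<epsilon>" "\<epsilon> \<le> 1" "\<And>a. a \<in> R \<Longrightarrow> \<epsilon> \<le> nrm a"
proof -
  let ?S = "insert 1 (nrm ` {a \<in> R. nrm a \<le> 1})"
  have fin: "finite ?S"
    using assms(2) by (simp add: norm_finite_def)
  have pos: "0 < nrm a" if "a \<in> R" for a
    using assms that unfolding division_ring_norm_def norm_finite_def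
    by (metis ComplD order_le_less singletonI subsetD)
  have "0 < Min ?S"
    using fin pos by (subst Min_gr_iff) auto
  moreover have le1: "Min ?S \<le> 1"
    using fin by (intro Min_le) auto
  moreover have "Min ?S \<le> nrm a" if "a \<in> R" for a
  proof (cases "nrm a \<le> 1")
    case True
    then show ?thesis using fin that by (intro Min_le) auto
  next
    case False
    then show ?thesis using le1 by linarith
  qed
  ultimately show ?thesis by (rule that)
qed

text \<open>
  Reading the indices of a frieze modulo \<open>m\<close> allows walking around the polygon in \<open>nat\<close>
  without case distinctions at the vertex \<open>0\<close>.
\<close>

definition periodic_entry :: "nat \<Rightarrow> (nat \<times> nat \<Rightarrow> 'a) \<Rightarrow> nat \<Rightarrow> nat \<Rightarrow> 'a" where
  "periodic_entry m c i j = c (i mod m, j mod m)"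

lemma add_mod_neq:
  fixes i a b m :: nat
  assumes "a < b" "b < m + a"
  shows "(i + a) mod m \<noteq> (i + b) mod m"
proof
  assume "(i + a) mod m = (i + b) mod m"
  then have "m dvd (i + b) - (i + a)"
    using assms mod_eq_dvd_iff_nat[of "i + a" "i + b" m] by simp
  then show False
    using assms by (auto dest: dvd_imp_le)
qed

lemma periodic_entry_mem:
  assumes "nc_frieze_over R m c" "a < b" "b < m + a"
  shows "periodic_entry m c (i + a) (i + b) \<in> R" "periodic_entry m c (i + b) (i + a) \<in> R"
proof -
  have "3 \<le> m" using assms(1) by (simp add: nc_frieze_over_def nc_frieze_def)
  then have "((i + a) mod m, (i + b) mod m) \<in> diag m" "((i + b) mod m, (i + a) mod m) \<in> diag m"
    using add_mod_neq[OF assms(2,3), of i] by (auto simp: diag_def)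
  then show "periodic_entry m c (i + a) (i + b) \<in> R" "periodic_entry m c (i + b) (i + a) \<in> R"
    using assms(1) by (auto simp: nc_frieze_over_def periodic_entry_def)
qed

lemma periodic_entry_boundary:
  assumes "unit_boundary m c" "0 < m"
  shows "periodic_entry m c i (i + 1) = 1" "periodic_entry m c (i + 1) i = 1"
  using assms(1)[unfolded unit_boundary_def, rule_format, of "i mod m"] assms(2)
  by (auto simp: periodic_entry_def nxt_def mod_Suc_eq)

lemma exchange_relation_unit_boundary:
  assumes "nc_frieze m c" "unit_boundary m c" "2 \<le> k" "k + 1 < m"
  shows "periodic_entry m c (i + 1) (i + (k + 1)) =
    inverse (periodic_entry m c (i + k) i) +
    periodic_entry m c (i + 1) (i + k) * inverse (periodic_entry m c i (i + k))
      * periodic_entry m c i (i + (k + 1))"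
proof -
  have m: "0 < m" using assms by simp
  have nxt: "nxt m (j mod m) = (j + 1) mod m" for j
    by (simp add: nxt_def mod_Suc_eq)
  have "distinct [i mod m, (i + 1) mod m, (i + k) mod m, (i + k + 1) mod m]"
    using add_mod_neq[of 0 1 m i] add_mod_neq[of 0 k m i] add_mod_neq[of 0 "k + 1" m i]
      add_mod_neq[of 1 k m i] add_mod_neq[of 1 "k + 1" m i] add_mod_neq[of k "k + 1" m i] assms
    by (simp add: add.assoc)
  with assms(1) m have
    "c ((i + 1) mod m, (i + k + 1) mod m) =
       c ((i + 1) mod m, i mod m) * inverse (c ((i + k) mod m, i mod m))
         * c ((i + k) mod m, (i + k + 1) mod m)
       + c ((i + 1) mod m, (i + k) mod m) * inverse (c (i mod m, (i + k) mod m))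
         * c (i mod m, (i + k + 1) mod m)"
    unfolding nc_frieze_def Let_def
    by (metis (no_types, lifting) nxt mod_less_divisor)
  then show ?thesis
    using periodic_entry_boundary[OF assms(2) m, of i]
      periodic_entry_boundary[OF assms(2) m, of "i + k"]
    by (simp add: periodic_entry_def add.assoc)
qed

text \<open>
  The telescoping argument: the exchange relation adds one term of norm at most
  \<open>1/\<epsilon>\<^sup>2\<close> per step. The hypothesis \<open>\<epsilon> \<le> 1\<close> absorbs the initial ratio, of norm at most \<open>1/\<epsilon>\<close>, into
  the same bound.
\<close>

lemma row_ratio_bound:
  assumes norm: "division_ring_norm nrm"
    and frieze: "nc_frieze_over R m c" "unit_boundary m c"
    and \<epsilon>: "0 < \<epsilon>" "\<epsilon> \<le> 1" "\<And>a. a \<in> R \<Longrightarrow> \<epsilon> \<le> nrm a"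
    and k: "2 \<le> k" "k < m"
  shows "nrm (periodic_entry m c (i + 1) (i + k) * inverse (periodic_entry m c i (i + k)))
    \<le> real (k - 1) / \<epsilon>\<^sup>2"
proof -
  let ?C = "periodic_entry m c"
  have nz: "a \<noteq> 0" if "a \<in> R" for a
    using \<epsilon>(1) \<epsilon>(3)[OF that] norm unfolding division_ring_norm_def by (metis not_less)
  have inv: "nrm (inverse a) \<le> 1 / \<epsilon>" if "a \<in> R" for a
    using division_ring_norm_inverse[OF norm nz[OF that]] \<epsilon>(1) \<epsilon>(3)[OF that]
    by (simp add: frac_le)
  show ?thesis
    using k
  proof (induction k rule: dec_induct)
    case base
    have "?C (i + 1) (i + 2) = 1"
      using periodic_entry_boundary(1)[OF frieze(2), of "i + 1"] base by simp
    moreover have "nrm (inverse (?C i (i + 2))) \<le> 1 / \<epsilon>"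
      using inv periodic_entry_mem(1)[OF frieze(1), of 0 2 i] base by simp
    moreover have "1 / \<epsilon> \<le> 1 / \<epsilon>\<^sup>2"
      using \<epsilon> by (simp add: field_simps power2_eq_square)
    ultimately show ?case by simp
  next
    case (step k)
    let ?x = "?C i (i + k)" and ?x' = "?C i (i + (k + 1))" and ?p = "?C (i + k) i"
      and ?y = "?C (i + 1) (i + k)" and ?y' = "?C (i + 1) (i + (k + 1))"
    have x': "?x' \<in> R" and p: "?p \<in> R"
      using periodic_entry_mem(1)[OF frieze(1), of 0 "k + 1" i]
        periodic_entry_mem(2)[OF frieze(1), of 0 k i] step by auto
    have "?y' = inverse ?p + ?y * inverse ?x * ?x'"
      using exchange_relation_unit_boundary[of m c k i] frieze step
      by (simp add: nc_frieze_over_def)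
    then have "?y' * inverse ?x' = inverse ?p * inverse ?x' + ?y * inverse ?x"
      using nz[OF x'] by (simp add: distrib_right mult.assoc)
    then have "nrm (?y' * inverse ?x') \<le> nrm (inverse ?p) * nrm (inverse ?x') + nrm (?y * inverse ?x)"
      using norm unfolding division_ring_norm_def by metis
    also have "\<dots> \<le> 1 / \<epsilon> * (1 / \<epsilon>) + real (k - 1) / \<epsilon>\<^sup>2"
      using inv[OF p] inv[OF x'] step norm \<epsilon>(1)
      by (intro add_mono mult_mono) (auto simp: division_ring_norm_def)
    also have "\<dots> = real (Suc k - 1) / \<epsilon>\<^sup>2"
      using step by (simp add: power2_eq_square add_divide_distrib [symmetric] of_nat_diff)
    finally show ?case by simp
  qed
qed

text \<open>
  As \<open>k\<close> runs from \<open>1\<close> to \<open>m - 1\<close>, the vertex \<open>i + k\<close> runs through all vertices other than \<open>i\<close>, on both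
  sides of it; so the bound reaches the entries of both orientations.
\<close>

lemma entry_bound:
  assumes norm: "division_ring_norm nrm"
    and frieze: "nc_frieze_over R m c" "unit_boundary m c"
    and \<epsilon>: "0 < \<epsilon>" "\<epsilon> \<le> 1" "\<And>a. a \<in> R \<Longrightarrow> \<epsilon> \<le> nrm a"
    and k: "1 \<le> k" "k < m"
  shows "nrm (periodic_entry m c (i + k) i) \<le> (real m / \<epsilon>\<^sup>2) ^ (k - 1)"
  using k
proof (induction k rule: dec_induct)
  case base
  then show ?case
    using periodic_entry_boundary(2)[OF frieze(2), of i] division_ring_norm_one[OF norm] by simp
next
  case (step k)
  let ?x = "periodic_entry m c (i + k) i" and ?y = "periodic_entry m c (i + k + 1) i"
  (* The column i is reached from the vertex i + k after m - k further steps around the polygon. *)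
  have "periodic_entry m c j (i + k + (m - k)) = periodic_entry m c j i" for j
    using step by (simp add: periodic_entry_def)
  then have "nrm (?y * inverse ?x) \<le> real (m - k - 1) / \<epsilon>\<^sup>2"
    using row_ratio_bound[OF norm frieze \<epsilon>, of "m - k" "i + k"] step by simp
  also have "\<dots> \<le> real m / \<epsilon>\<^sup>2"
    by (intro divide_right_mono) auto
  finally have ratio: "nrm (?y * inverse ?x) \<le> real m / \<epsilon>\<^sup>2" .
  have "?x \<in> R"
    using periodic_entry_mem(2)[OF frieze(1), of 0 k i] step by simp
  then have "?x \<noteq> 0"
    using \<epsilon>(1) \<epsilon>(3)[of ?x] norm unfolding division_ring_norm_def by (metis not_less)
  then have "?y = ?y * inverse ?x * ?x"
    by (simp add: mult.assoc)
  then have "nrm ?y = nrm (?y * inverse ?x) * nrm ?x"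
    using norm unfolding division_ring_norm_def by metis
  also have "\<dots> \<le> real m / \<epsilon>\<^sup>2 * (real m / \<epsilon>\<^sup>2) ^ (k - 1)"
    using ratio step norm by (intro mult_mono) (auto simp: division_ring_norm_def)
  also have "\<dots> = (real m / \<epsilon>\<^sup>2) ^ (Suc k - 1)"
    using step by (simp add: power_eq_if)
  finally show ?case by simp
qed

theorem corollary4p4:
  fixes nrm :: "'a::division_ring \<Rightarrow> real" and R :: "'a set"
  assumes "division_ring_norm nrm" and "norm_finite nrm R"
  shows "\<forall>n::nat. finite (unit_boundary_friezes R n)"
proof
  fix n :: nat
  define m where "m = n + 3"
  obtain \<epsilon> where \<epsilon>: "0 < \<epsilon>" "\<epsilon> \<le> 1" "\<And>a. a \<in> R \<Longrightarrow> \<epsilon> \<le> nrm a"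
    using norm_finite_bounded_below[OF assms] by blast
  define K where "K = real m / \<epsilon>\<^sup>2"
  have "\<epsilon>\<^sup>2 \<le> 1"
    using \<epsilon> by (simp add: power_le_one)
  then have K: "1 \<le> K"
    using \<epsilon>(1) by (simp add: K_def m_def field_simps)
  have "unit_boundary_friezes R n \<subseteq> diag m \<rightarrow>\<^sub>E {a \<in> R. nrm a \<le> K ^ m}"
  proof
    fix c assume "c \<in> unit_boundary_friezes R n"
    then have c: "nc_frieze_over R m c" "unit_boundary m c"
      by (auto simp: unit_boundary_friezes_def m_def)
    have bound: "nrm (periodic_entry m c (s + k) s) \<le> K ^ m" if "1 \<le> k" "k < m" for s k
    proof -
      have "nrm (periodic_entry m c (s + k) s) \<le> K ^ (k - 1)"
        using entry_bound[OF assms(1) c \<epsilon> that] by (simp add: K_def)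
      also have "\<dots> \<le> K ^ m"
        using K that by (intro power_increasing) auto
      finally show ?thesis .
    qed
    have "nrm (c (r, s)) \<le> K ^ m" if "(r, s) \<in> diag m" for r s
    proof (cases "s < r")
      case True
      then show ?thesis
        using bound[of "r - s" s] that by (auto simp: diag_def periodic_entry_def Suc_le_eq)
    next
      case False
      then show ?thesis
        using bound[of "m + r - s" s] that by (auto simp: diag_def periodic_entry_def)
    qed
    then show "c \<in> diag m \<rightarrow>\<^sub>E {a \<in> R. nrm a \<le> K ^ m}"
      using c(1) by (auto simp: nc_frieze_over_def nc_frieze_def PiE_iff)
  qed
  moreover have "finite (diag m)"
    by (rule finite_subset[of _ "{..<m} \<times> {..<m}"]) (auto simp: diag_def)
  then have "finite (diag m \<rightarrow>\<^sub>E {a \<in> R. nrm a \<le> K ^ m})"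
    using assms(2) by (intro finite_PiE) (auto simp: norm_finite_def)
  ultimately show "finite (unit_boundary_friezes R n)"
    by (rule finite_subset)
qed

end
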